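(* Let $\delta>0$, let $y,x_1,\ldots,x_m\in\mathbb{C}^n$, and let $X=[x_1\; x_2\;\cdots\; x_m]\in\mathbb{C}^{n\times m}$ be the matrix whose columns are $x_1,\ldots,x_m$. Suppose that $r=\mathrm{rk}_\delta(X)>0$, and set $s_{n,m}(r)=\sqrt{r(\min\{m,n\}-r)}$. Then there are a rank $r$ orthogonal projector $Q\in\mathbb{C}^{n\times n}$, $r$ vectors $x_{j_1},\ldots,x_{j_r}\in\{x_1,\ldots,x_m\}$ and $r$ scalars $c_1,\ldots,c_r\in\mathbb{C}$ such that $$\|X-QX\|_F\leq \frac{s_{n,m}(r)}{\sqrt{r}}\,\delta$$ and $$\left\|y-\sum_{k=1}^r c_kx_{j_k}\right\|\leq \left(\sum_{k=1}^r|c_k|^2\right)^{1/2}s_{n,m}(r)\,\delta+\|(I_n-Q)y\|.$$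
   Context: For $\delta>0$ and a matrix $A\in\mathbb{C}^{m\times n}$, $\mathrm{rk}_\delta(A)$ denotes the number of indices $j\in\{1,\ldots,\min\{m,n\}\}$ with $s_j(A)>\delta$, where $s_1(A),\ldots,s_{\min\{m,n\}}(A)$ are the singular values of $A$ (from an economy-sized singular value decomposition, counted with multiplicity). An orthogonal projector is a square complex matrix $P$ with $P^2=P=P^\ast$. $\|\cdot\|$ is the Euclidean norm on $\mathbb{C}^n$, $\|\cdot\|_F$ is the Frobenius norm, and $I_n$ is the $n\times n$ identity matrix. *)

theory Defs
  imports
    Complex_Main
    "Jordan_Normal_Form.Schur_Decomposition"
    "Jordan_Normal_Form.DL_Rank"
begin

definition vec_norm2 :: "complex vec \<Rightarrow> real" where
  "vec_norm2 v = sqrt (\<Sum>i<dim_vec v. (cmod (v $ i))\<^sup>2)"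

definition frobenius_norm :: "complex mat \<Rightarrow> real" where
  "frobenius_norm A = sqrt (\<Sum>i<dim_row A. \<Sum>j<dim_col A. (cmod (A $$ (i, j)))\<^sup>2)"

definition orthogonal_projector :: "complex mat \<Rightarrow> bool" where
  "orthogonal_projector P \<longleftrightarrow> square_mat P \<and> P * P = P \<and> mat_adjoint P = P"

text \<open>With \<open>k = min (dim_row A) (dim_col A)\<close>: \<open>A = U \<Sigma> V\<^sup>*\<close>, where \<open>U\<close> and \<open>V\<close> have \<open>k\<close>
  orthonormal columns and \<open>\<Sigma>\<close> is the \<open>k \<times> k\<close> diagonal matrix with the entries of the list
  \<open>s\<close> (nonnegative, weakly decreasing) on its diagonal.\<close>

definition economy_svd :: "complex mat \<Rightarrow> complex mat \<Rightarrow> real list \<Rightarrow> complex mat \<Rightarrow> bool" where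
  "economy_svd A U s V \<longleftrightarrow>
     (let k = min (dim_row A) (dim_col A) in
       U \<in> carrier_mat (dim_row A) k \<and> mat_adjoint U * U = 1\<^sub>m k \<and>
       V \<in> carrier_mat (dim_col A) k \<and> mat_adjoint V * V = 1\<^sub>m k \<and>
       length s = k \<and> (\<forall>t\<in>set s. 0 \<le> t) \<and> sorted_wrt (\<ge>) s \<and>
       A = U * mat_diag k (\<lambda>i. complex_of_real (s ! i)) * mat_adjoint V)"

text \<open>Every complex matrix has an economy-sized singular value decomposition, and the decreasing
  list \<open>s\<close> does not depend on the decomposition, so the choice below is harmless. Indices are
  shifted by one: \<open>s\<^sub>j(A) = singular_values A ! (j - 1)\<close>.\<close>

definition singular_values :: "complex mat \<Rightarrow> real list" where
  "singular_values A = (SOME s. \<exists>U V. economy_svd A U s V)"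

definition rk :: "real \<Rightarrow> complex mat \<Rightarrow> nat" where
  "rk \<delta> A = card {j. j < min (dim_row A) (dim_col A) \<and> singular_values A ! j > \<delta>}"

definition s_nmr :: "nat \<Rightarrow> nat \<Rightarrow> nat \<Rightarrow> real" where
  "s_nmr n m r = sqrt (real r * (real (min m n) - real r))"

end

theory Submission
  imports Defs "Jordan_Normal_Form.Spectral_Radius" "HOL-Analysis.L2_Norm"
begin

text \<open>Let \<open>W\<close> collect the left singular vectors of \<open>X\<close> for the \<open>r\<close> singular values above \<open>\<delta>\<close> and put
  \<open>Q = W W\<^sup>*\<close>. The nonzero singular values of \<open>X - Q X\<close> are among the \<open>min {m, n} - r\<close> values that do not
  exceed \<open>\<delta>\<close>, which bounds its Frobenius norm. The coordinate matrix \<open>W\<^sup>* X\<close> has full row rank \<open>r\<close>,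
  so \<open>r\<close> of its columns form a basis, and \<open>W\<^sup>* y = \<Sum> c\<^sub>k W\<^sup>* x\<^bsub>j\<^sub>k\<^esub>\<close> is solvable. Then
  \<open>y - \<Sum> c\<^sub>k x\<^bsub>j\<^sub>k\<^esub> = (I - Q) y - \<Sum> c\<^sub>k (I - Q) x\<^bsub>j\<^sub>k\<^esub>\<close>, and by Cauchy-Schwarz the last sum is at most
  \<open>(\<Sum> |c\<^sub>k|\<^sup>2)\<^sup>1\<^sup>/\<^sup>2 \<parallel>X - Q X\<parallel>\<^sub>F\<close>. The singular
  value decomposition itself comes from an orthonormal eigenbasis of \<open>X\<^sup>* X\<close>.\<close>

section \<open>Adjoints and inner products\<close>

text \<open>Dimension equations in place of carrier sets let the simplifier rebracket a product by
  comparing sizes alone.\<close>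

lemma mult_mat_assoc_dim:
  fixes A :: "'a :: semiring_0 mat"
  assumes "dim_col A = dim_row B" "dim_col B = dim_row C"
  shows "A * B * C = A * (B * C)"
  using assms by (intro assoc_mult_mat[of _ "dim_row A" "dim_col A" _ "dim_col B" _ "dim_col C"]) auto

lemma mult_mat_vec_assoc_dim:
  fixes A :: "'a :: semiring_0 mat"
  assumes "dim_col A = dim_row B" "dim_col B = dim_vec v"
  shows "A * B *\<^sub>v v = A *\<^sub>v (B *\<^sub>v v)"
  using assms by (intro assoc_mult_mat_vec[of _ "dim_row A" "dim_col A" _ "dim_col B"]) auto

lemma mat_adjoint_dim [simp]:
  "dim_row (mat_adjoint A) = dim_col A" "dim_col (mat_adjoint A) = dim_row A"
  by (simp_all add: mat_adjoint_def)

lemma mat_adjoint_carrier [simp]: "A \<in> carrier_mat n m \<Longrightarrow> mat_adjoint A \<in> carrier_mat m n"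
  by (auto intro: carrier_matI)

lemma mat_adjoint_index [simp]:
  assumes "i < dim_col A" "j < dim_row A"
  shows "mat_adjoint A $$ (i, j) = conjugate (A $$ (j, i))"
  using assms by (simp add: mat_adjoint_def mat_of_rows_def)

lemma mat_adjoint_adjoint [simp]: "mat_adjoint (mat_adjoint A) = A"
  by (rule eq_matI) auto

lemma mat_adjoint_mult:
  fixes A B :: "complex mat"
  assumes "dim_col A = dim_row B"
  shows "mat_adjoint (A * B) = mat_adjoint B * mat_adjoint A"
  using assms by (intro eq_matI) (auto simp: scalar_prod_def mult.commute)

lemma mat_adjoint_mult_index:
  fixes A B :: "complex mat"
  assumes "i < dim_col A" "j < dim_col B" "dim_row A = dim_row B"
  shows "(mat_adjoint A * B) $$ (i, j) = col B j \<bullet>c col A i"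
  using assms by (auto simp: scalar_prod_def mult.commute)

text \<open>Both sides are the same double sum over the entries of \<open>A\<close>, with the order
  of summation exchanged.\<close>

lemma cscalar_prod_adjoint:
  fixes A :: "complex mat"
  assumes "x \<in> carrier_vec (dim_col A)" "y \<in> carrier_vec (dim_row A)"
  shows "(A *\<^sub>v x) \<bullet>c y = x \<bullet>c (mat_adjoint A *\<^sub>v y)"
proof -
  have "(A *\<^sub>v x) \<bullet>c y = (\<Sum>i<dim_row A. \<Sum>j<dim_col A. A $$ (i, j) * x $ j * cnj (y $ i))"
    using assms by (auto simp: scalar_prod_def sum_distrib_right lessThan_atLeast0 intro!: sum.cong)
  also have "\<dots> = (\<Sum>j<dim_col A. \<Sum>i<dim_row A. A $$ (i, j) * x $ j * cnj (y $ i))"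
    by (rule sum.swap)
  also have "\<dots> = x \<bullet>c (mat_adjoint A *\<^sub>v y)"
    using assms by (auto simp: scalar_prod_def sum_distrib_left lessThan_atLeast0 ac_simps intro!: sum.cong)
  finally show ?thesis .
qed

lemma cscalar_prod_self: "v \<bullet>c v = complex_of_real ((vec_norm2 v)\<^sup>2)"
proof -
  have "v \<bullet>c v = (\<Sum>i<dim_vec v. complex_of_real ((cmod (v $ i))\<^sup>2))"
    by (simp add: scalar_prod_def lessThan_atLeast0 complex_norm_square del: of_real_power)
  also have "\<dots> = complex_of_real ((vec_norm2 v)\<^sup>2)"
    by (simp add: vec_norm2_def sum_nonneg)
  finally show ?thesis .
qed

lemma cscalar_prod_cnj:
  fixes v w :: "complex vec"
  assumes "dim_vec v = dim_vec w"
  shows "cnj (v \<bullet>c w) = w \<bullet>c v"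
  using assms by (simp add: scalar_prod_def mult.commute)

lemma vec_norm2_eq_0_iff: "v \<in> carrier_vec n \<Longrightarrow> vec_norm2 v = 0 \<longleftrightarrow> v = 0\<^sub>v n"
  using conjugate_square_eq_0_vec[of v n] by (simp add: cscalar_prod_self)

lemma vec_norm2_nonneg: "0 \<le> vec_norm2 v"
  by (simp add: vec_norm2_def sum_nonneg)

lemma cscalar_prod_smult:
  fixes v w :: "complex vec"
  assumes "dim_vec v = dim_vec w"
  shows "(a \<cdot>\<^sub>v v) \<bullet>c (b \<cdot>\<^sub>v w) = a * cnj b * (v \<bullet>c w)"
  using assms by (auto simp: scalar_prod_def sum_distrib_left ac_simps intro!: sum.cong)

section \<open>Orthonormal families and Hermitian matrices\<close>

text \<open>A family is a total function of which only the first \<open>t\<close> values count, so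
  that appending a vector is a function update.\<close>

definition orthonormal :: "nat \<Rightarrow> nat \<Rightarrow> (nat \<Rightarrow> complex vec) \<Rightarrow> bool" where
  "orthonormal n t u \<longleftrightarrow> (\<forall>i<t. u i \<in> carrier_vec n) \<and>
     (\<forall>i<t. \<forall>j<t. u i \<bullet>c u j = (if i = j then 1 else 0))"

definition colmat :: "nat \<Rightarrow> nat \<Rightarrow> (nat \<Rightarrow> complex vec) \<Rightarrow> complex mat" where
  "colmat n t u = mat n t (\<lambda>(i, j). u j $ i)"

lemma colmat_dim [simp]: "dim_row (colmat n t u) = n" "dim_col (colmat n t u) = t"
  by (simp_all add: colmat_def)

lemma colmat_carrier [simp]: "colmat n t u \<in> carrier_mat n t"
  by (auto intro: carrier_matI)

lemma colmat_index [simp]: "i < n \<Longrightarrow> j < t \<Longrightarrow> colmat n t u $$ (i, j) = u j $ i"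
  by (simp add: colmat_def)

lemma col_colmat [simp]: "j < t \<Longrightarrow> u j \<in> carrier_vec n \<Longrightarrow> col (colmat n t u) j = u j"
  by (intro eq_vecI) auto

lemma orthonormal_adjoint_mult:
  assumes "orthonormal n t u"
  shows "mat_adjoint (colmat n t u) * colmat n t u = 1\<^sub>m t"
proof (rule eq_matI)
  fix i j assume "i < dim_row (1\<^sub>m t :: complex mat)" "j < dim_col (1\<^sub>m t :: complex mat)"
  then show "(mat_adjoint (colmat n t u) * colmat n t u) $$ (i, j) = 1\<^sub>m t $$ (i, j)"
    using assms by (simp add: mat_adjoint_mult_index orthonormal_def col_colmat del: index_mult_mat(1))
qed auto

text \<open>A left inverse of a square matrix is also a right inverse. This is completeness: every
  vector is recovered from its coordinates in the basis \<open>u\<close>.\<close>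

lemma orthonormal_mult_adjoint:
  assumes "orthonormal n n u"
  shows "colmat n n u * mat_adjoint (colmat n n u) = 1\<^sub>m n"
  by (rule mat_mult_left_right_inverse[OF _ _ orthonormal_adjoint_mult[OF assms]])
    (auto intro: carrier_matI)

section \<open>Completing orthonormal families\<close>

lemma orthonormal_insert:
  assumes u: "orthonormal n t u" and v: "v \<in> carrier_vec n" "v \<noteq> 0\<^sub>v n"
    and uv: "\<And>i. i < t \<Longrightarrow> v \<bullet>c u i = 0"
  shows "orthonormal n (Suc t) (u(t := complex_of_real (1 / vec_norm2 v) \<cdot>\<^sub>v v))"
proof -
  let ?w = "complex_of_real (1 / vec_norm2 v) \<cdot>\<^sub>v v"
  have nz: "vec_norm2 v \<noteq> 0" using v vec_norm2_eq_0_iff by blast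
  have w: "?w \<in> carrier_vec n" using v by simp
  have ww: "?w \<bullet>c ?w = 1"
  proof -
    have "?w \<bullet>c ?w = complex_of_real (1 / vec_norm2 v) * cnj (complex_of_real (1 / vec_norm2 v)) * (v \<bullet>c v)"
      by (rule cscalar_prod_smult[OF refl])
    also have "\<dots> = 1" unfolding cscalar_prod_self using nz by (simp add: power2_eq_square)
    finally show ?thesis .
  qed
  have wu: "?w \<bullet>c u i = 0" if "i < t" for i
    using cscalar_prod_smult[of v "u i" _ 1] uv[OF that] v u that by (auto simp: orthonormal_def)
  have uw: "u i \<bullet>c ?w = 0" if "i < t" for i
    using cscalar_prod_cnj[of ?w "u i"] wu[OF that] u that w by (auto simp: orthonormal_def)
  show ?thesis
    using u w ww wu uw by (auto simp: orthonormal_def less_Suc_eq)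
qed

text \<open>The conjugates of the \<open>t < n\<close> given vectors, padded with zero rows to a
  square matrix, give determinant 0. A nonzero kernel vector is orthogonal to the whole family and
  only has to be normalized.\<close>

lemma orthonormal_extend_one:
  assumes u: "orthonormal n t u" and "t < n"
  shows "\<exists>v. orthonormal n (Suc t) (u(t := v))"
proof -
  let ?c = "\<lambda>i. if i < t then conjugate (u i) else 0\<^sub>v n"
  let ?A = "mat\<^sub>r n n (\<lambda>i. if i = t then 0\<^sub>v n else ?c i)"
  have c: "?c i \<in> carrier_vec n" for i using u by (auto simp: orthonormal_def)
  have "det ?A = 0" by (rule det_row_0) (use assms c in auto)
  then obtain v where v: "v \<in> carrier_vec n" "v \<noteq> 0\<^sub>v n" and Av: "?A *\<^sub>v v = 0\<^sub>v n"
    using det_0_iff_vec_prod_zero_field[of ?A n] by auto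
  have "v \<bullet>c u i = 0" if "i < t" for i
  proof -
    have ui: "u i \<in> carrier_vec n" using u that by (simp add: orthonormal_def)
    have row: "row ?A i = conjugate (u i)"
      using that assms ui by (subst row_mat_of_row_fun) auto
    have "0 = (?A *\<^sub>v v) $ i" unfolding Av using that assms by simp
    also have "\<dots> = conjugate (u i) \<bullet> v"
      using that assms row by (subst index_mult_mat_vec) auto
    also have "\<dots> = v \<bullet>c u i" using v(1) ui by (simp add: comm_scalar_prod[of _ n])
    finally show ?thesis by simp
  qed
  from orthonormal_insert[OF u v this] show ?thesis by blast
qed

lemma orthonormal_extend:
  assumes u: "orthonormal n t u" and "t \<le> k" "k \<le> n"
  shows "\<exists>w. orthonormal n k w \<and> (\<forall>i<t. w i = u i)"
  using assms(2,3)
proof (induction k rule: dec_induct)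
  case base
  then show ?case using u by blast
next
  case (step k)
  then obtain w where w: "orthonormal n k w" "\<forall>i<t. w i = u i" by auto
  from orthonormal_extend_one[OF w(1)] step.prems obtain v where "orthonormal n (Suc k) (w(k := v))"
    by auto
  with w(2) step.hyps show ?case by (intro exI[of _ "w(k := v)"]) (auto simp del: fun_upd_apply, simp)
qed

text \<open>Eigenvectors are collected one at a time: if the columns of \<open>N\<close> are an orthonormal basis of the
  orthogonal complement of those already found, then \<open>M\<close> preserves the range of \<open>N\<close>, so an eigenvector
  \<open>z\<close> of the compression \<open>N\<^sup>* M N\<close> gives the eigenvector \<open>N z\<close> of \<open>M\<close>.\<close>

lemma hermitian_eigenvectors_partial:
  assumes M: "M \<in> carrier_mat m m" and herm: "mat_adjoint M = M" and "t \<le> m"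
  shows "\<exists>v \<mu>. orthonormal m t v \<and> (\<forall>i<t. M *\<^sub>v v i = \<mu> i \<cdot>\<^sub>v v i)"
  using \<open>t \<le> m\<close>
proof (induction t)
  case 0
  show ?case by (auto simp: orthonormal_def)
next
  case (Suc t)
  then obtain v \<mu> where v: "orthonormal m t v" and ev: "\<And>i. i < t \<Longrightarrow> M *\<^sub>v v i = \<mu> i \<cdot>\<^sub>v v i"
    by auto
  from orthonormal_extend[OF v, of m] Suc.prems obtain w
    where w: "orthonormal m m w" and wv: "\<And>i. i < t \<Longrightarrow> w i = v i" by auto
  have wc: "w i \<in> carrier_vec m" if "i < m" for i using w that by (simp add: orthonormal_def)
  define N where "N = colmat m (m - t) (\<lambda>i. w (t + i))"
  have N: "N \<in> carrier_mat m (m - t)" by (simp add: N_def)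
  have colN: "col N i = w (t + i)" if "i < m - t" for i
    using that wc by (simp add: N_def col_colmat)
  have "orthonormal m (m - t) (\<lambda>i. w (t + i))" using w by (auto simp: orthonormal_def)
  then have NN: "mat_adjoint N * N = 1\<^sub>m (m - t)"
    unfolding N_def by (rule orthonormal_adjoint_mult)
  let ?B = "mat_adjoint N * M * N"
  have B: "?B \<in> carrier_mat (m - t) (m - t)" using N M by (auto intro: carrier_matI)
  \<comment> \<open>The size \<open>m - t\<close> is positive because \<open>Suc t \<le> m\<close>,
    so the compression has an eigenvalue over the complex numbers.\<close>
  have "spectrum ?B \<noteq> {}" using spectrum_non_empty[OF B] Suc.prems by simp
  then obtain l z where z: "z \<in> carrier_vec (m - t)" "z \<noteq> 0\<^sub>v (m - t)" and Bz: "?B *\<^sub>v z = l \<cdot>\<^sub>v z"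
    using B N unfolding spectrum_def eigenvalue_def eigenvector_def by auto
  define x where "x = N *\<^sub>v z"
  have x: "x \<in> carrier_vec m" using N by (simp add: x_def carrier_vecI)
  have Nx: "mat_adjoint N *\<^sub>v x = z"
    using N z NN by (simp add: x_def mult_mat_vec_assoc_dim[symmetric])
  have x0: "x \<noteq> 0\<^sub>v m"
    using Nx z N by auto
  have xw: "x \<bullet>c w i = 0" if "i < t" for i
  proof -
    have "(mat_adjoint N *\<^sub>v w i) = 0\<^sub>v (m - t)"
    proof (rule eq_vecI)
      fix j assume "j < dim_vec (0\<^sub>v (m - t) :: complex vec)"
      then have j: "j < m - t" by simp
      have "(mat_adjoint N *\<^sub>v w i) $ j = w i \<bullet>c col N j"
        using j N wc[of i] that Suc.prems by (auto simp: scalar_prod_def mult.commute)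
      also have "\<dots> = 0" using w j that Suc.prems by (simp add: colN orthonormal_def)
      finally show "(mat_adjoint N *\<^sub>v w i) $ j = 0\<^sub>v (m - t) $ j" using j by simp
    qed (use N in auto)
    moreover have "x \<bullet>c w i = z \<bullet>c (mat_adjoint N *\<^sub>v w i)"
      unfolding x_def using cscalar_prod_adjoint[of z N "w i"] N z wc[of i] that Suc.prems by simp
    ultimately show ?thesis using z by simp
  qed
  \<comment> \<open>The defect \<open>y\<close> of the eigenvector equation is shown to be
    orthogonal to every member of the basis \<open>w\<close>, hence zero.\<close>
  define y where "y = M *\<^sub>v x - l \<cdot>\<^sub>v x"
  have Mx: "M *\<^sub>v x \<in> carrier_vec m" using M by (simp add: carrier_vecI)
  have y: "y \<in> carrier_vec m" using x Mx by (simp add: y_def)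
  have yw: "y \<bullet>c w i = 0" if i: "i < m" for i
  proof -
    have *: "y \<bullet>c w i = (M *\<^sub>v x) \<bullet>c w i - l * (x \<bullet>c w i)"
      unfolding y_def using x Mx wc[OF i] by (simp add: minus_scalar_prod_distrib[of _ m])
    show ?thesis
    proof (cases "i < t")
      case True
      \<comment> \<open>Against an eigenvector already found, \<open>M\<close> moves to the other
        factor since it is Hermitian, which leaves a multiple of the vanishing product of
        \<open>x\<close> and \<open>w i\<close>.\<close>
      have "(M *\<^sub>v x) \<bullet>c w i = x \<bullet>c (\<mu> i \<cdot>\<^sub>v w i)"
        using cscalar_prod_adjoint[of x M "w i"] M x wc[OF i] herm ev[OF True] wv[OF True] by simp
      also have "\<dots> = cnj (\<mu> i) * (x \<bullet>c w i)"
        using cscalar_prod_smult[of x "w i" 1 "\<mu> i"] x wc[OF i] by simp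
      finally show ?thesis using * xw[OF True] by simp
    next
      case False
      define j where "j = i - t"
      have j: "j < m - t" "i = t + j" using False i by (auto simp: j_def)
      \<comment> \<open>For \<open>i \<ge> t\<close> the vector \<open>w i\<close> is column
        \<open>j\<close> of \<open>N\<close>, so the inner product reads off a coordinate in the
        compressed space, where \<open>z\<close> is an eigenvector.\<close>
      have adj: "q \<bullet>c w i = (mat_adjoint N *\<^sub>v q) $ j" if "q \<in> carrier_vec m" for q
        using that j N colN[OF j(1), symmetric] by (auto simp: scalar_prod_def mult.commute)
      have "mat_adjoint N *\<^sub>v (M *\<^sub>v x) = l \<cdot>\<^sub>v z"
        using Bz N M z by (simp add: x_def mult_mat_vec_assoc_dim)
      then show ?thesis
        unfolding * adj[OF x] adj[OF Mx] Nx using z j by simp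
    qed
  qed
  have Wy: "mat_adjoint (colmat m m w) *\<^sub>v y = 0\<^sub>v m"
  proof (rule eq_vecI)
    fix i assume "i < dim_vec (0\<^sub>v m :: complex vec)"
    then have i: "i < m" by simp
    have "(mat_adjoint (colmat m m w) *\<^sub>v y) $ i = y \<bullet>c w i"
      using i y wc[OF i] by (auto simp: scalar_prod_def mult.commute)
    then show "(mat_adjoint (colmat m m w) *\<^sub>v y) $ i = 0\<^sub>v m $ i" using yw[OF i] i by simp
  qed auto
  have "y = colmat m m w *\<^sub>v (mat_adjoint (colmat m m w) *\<^sub>v y)"
    using y orthonormal_mult_adjoint[OF w] by (simp add: mult_mat_vec_assoc_dim[symmetric])
  then have y0: "y = 0\<^sub>v m" unfolding Wy by auto
  have Mxl: "M *\<^sub>v x = l \<cdot>\<^sub>v x"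
  proof (rule eq_vecI)
    fix i assume "i < dim_vec (l \<cdot>\<^sub>v x)"
    then have i: "i < m" using x by simp
    have "y $ i = 0" using y0 i by simp
    then show "(M *\<^sub>v x) $ i = (l \<cdot>\<^sub>v x) $ i" using i x Mx M unfolding y_def by simp
  qed (use M x in auto)
  let ?x = "complex_of_real (1 / vec_norm2 x) \<cdot>\<^sub>v x"
  have "orthonormal m (Suc t) (v(t := ?x))"
    by (rule orthonormal_insert[OF v x x0]) (use xw wv in auto)
  moreover have "M *\<^sub>v ?x = l \<cdot>\<^sub>v ?x"
    using M x Mxl by (simp add: mult_mat_vec[of M m m] smult_smult_assoc mult.commute)
  ultimately show ?case
    using ev by (intro exI[of _ "v(t := ?x)"] exI[of _ "\<mu>(t := l)"] conjI) (assumption, auto simp: less_Suc_eq)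
qed

text \<open>For a decreasing list this turns the number of indices with values above a threshold
  into the position where the values drop to it.\<close>

lemma downward_closed_eq_lessThan:
  fixes S :: "nat set"
  assumes fin: "finite S" and closed: "\<And>x y. x \<in> S \<Longrightarrow> y \<le> x \<Longrightarrow> y \<in> S"
  shows "S = {..<card S}"
proof (cases "S = {}")
  case False
  have "x \<in> S \<longleftrightarrow> x < Suc (Max S)" for x
    using Max_ge[OF fin, of x] closed[OF Max_in[OF fin False], of x] by (auto simp: less_Suc_eq_le)
  then have S: "S = {..<Suc (Max S)}" by blast
  have "card S = card {..<Suc (Max S)}" by (rule arg_cong[OF S])
  then have "card S = Suc (Max S)" by simp
  then show ?thesis using S by (rule ssubst)
qed simp

section \<open>Existence of the economy-sized singular value decomposition\<close>

lemma mat_diag_dims [simp]: "dim_row (mat_diag n f) = n" "dim_col (mat_diag n f) = n"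
  by (simp_all add: mat_diag_def)

lemma mat_adjoint_of_real_diag:
  "mat_adjoint (mat_diag n (\<lambda>i. complex_of_real (s i))) = mat_diag n (\<lambda>i. complex_of_real (s i))"
  by (rule eq_matI) (auto simp: mat_diag_def)

text \<open>The right singular vectors are orthonormal eigenvectors of
  \<open>mat_adjoint A * A\<close>. Their images under \<open>A\<close> are pairwise orthogonal, the
  norms of the images are the singular values, and the normalized nonzero images are left singular
  vectors. The assumption \<open>m \<le> n\<close> leaves room for completing the latter to
  \<open>m\<close> vectors.\<close>

lemma economy_svd_exists_tall:
  assumes A: "A \<in> carrier_mat n m" and "m \<le> n"
  shows "\<exists>U s V. economy_svd A U s V"
proof -
  let ?M = "mat_adjoint A * A"
  have "?M \<in> carrier_mat m m" using A by (auto intro: carrier_matI)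
  moreover have "mat_adjoint ?M = ?M" by (simp add: mat_adjoint_mult)
  ultimately have "\<exists>v \<mu>. orthonormal m m v \<and> (\<forall>i<m. ?M *\<^sub>v v i = \<mu> i \<cdot>\<^sub>v v i)"
    by (rule hermitian_eigenvectors_partial) simp
  then obtain v \<mu> where v: "orthonormal m m v" and ev: "\<And>i. i < m \<Longrightarrow> ?M *\<^sub>v v i = \<mu> i \<cdot>\<^sub>v v i"
    by (elim exE conjE) simp
  have vc: "v i \<in> carrier_vec m" if "i < m" for i using v that by (simp add: orthonormal_def)
  have Av: "(A *\<^sub>v v i) \<bullet>c (A *\<^sub>v v j) = 0" if "i < m" "j < m" "i \<noteq> j" for i j
  proof -
    have "(A *\<^sub>v v i) \<bullet>c (A *\<^sub>v v j) = v i \<bullet>c (?M *\<^sub>v v j)"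
    proof -
      have c: "v i \<in> carrier_vec (dim_col A)" "A *\<^sub>v v j \<in> carrier_vec (dim_row A)"
        "dim_vec (v j) = dim_col A"
        using A vc[OF that(1)] vc[OF that(2)] by (auto intro: carrier_vecI)
      have "?M *\<^sub>v v j = mat_adjoint A *\<^sub>v (A *\<^sub>v v j)"
        by (rule mult_mat_vec_assoc_dim) (use c in simp_all)
      with cscalar_prod_adjoint[OF c(1,2)] show ?thesis by argo
    qed
    also have "\<dots> = cnj (\<mu> j) * (v i \<bullet>c v j)"
      unfolding ev[OF that(2)]
      using cscalar_prod_smult[of "v i" "v j" 1 "\<mu> j"] vc[of i] vc[of j] that by simp
    also have "\<dots> = 0" using v that by (simp add: orthonormal_def)
    finally show ?thesis .
  qed
  define \<sigma> where "\<sigma> i = vec_norm2 (A *\<^sub>v v i)" for i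
  \<comment> \<open>The eigenbasis comes in no particular order; \<open>ps\<close> is the
    permutation that makes the norms decrease.\<close>
  define ps where "ps = rev (sort_key \<sigma> [0..<m])"
  define w where "w i = v (ps ! i)" for i
  define s where "s i = \<sigma> (ps ! i)" for i
  have len: "length ps = m" and dist: "distinct ps" and set: "set ps = {0..<m}"
    by (simp_all add: ps_def)
  have ps: "ps ! i < m" if "i < m" for i
    using nth_mem[of i ps] that len set by auto
  have inj: "ps ! i = ps ! j \<longleftrightarrow> i = j" if "i < m" "j < m" for i j
    using nth_eq_iff_index_eq[OF dist] that len by simp
  have w: "orthonormal m m w"
    using v ps inj by (auto simp: orthonormal_def w_def)
  have wc: "w i \<in> carrier_vec m" if "i < m" for i using w that by (simp add: orthonormal_def)
  have "sorted_wrt (\<ge>) (map \<sigma> ps)"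
    unfolding ps_def rev_map[symmetric] sorted_wrt_rev by simp
  moreover have "map \<sigma> ps = map s [0..<m]"
    by (rule nth_equalityI) (simp_all add: len s_def)
  ultimately have sorted: "sorted_wrt (\<ge>) (map s [0..<m])" by simp
  have s_mono: "s j \<le> s i" if "i \<le> j" "j < m" for i j
    using sorted that sorted_wrt_nth_less[OF sorted, of i j] by (cases "i = j") auto
  have s_nonneg: "0 \<le> s i" for i by (simp add: s_def \<sigma>_def vec_norm2_nonneg)
  have Aw: "(A *\<^sub>v w i) \<bullet>c (A *\<^sub>v w j) = (if i = j then complex_of_real ((s i)\<^sup>2) else 0)"
    if "i < m" "j < m" for i j
    using Av[of "ps ! i" "ps ! j"] ps inj that
    by (auto simp: w_def s_def \<sigma>_def cscalar_prod_self)
  \<comment> \<open>By monotonicity the positive singular values are exactly those with index below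
    \<open>t\<close>.\<close>
  define t where "t = card {i. i < m \<and> s i > 0}"
  have "{i. i < m \<and> s i > 0} = {..<t}"
    unfolding t_def
    by (rule downward_closed_eq_lessThan) (use s_mono in \<open>force intro: less_le_trans\<close>)+
  then have t: "i < t \<longleftrightarrow> i < m \<and> s i > 0" for i by blast
  have "t \<le> m" using t[of m] by simp
  define u where "u i = complex_of_real (1 / s i) \<cdot>\<^sub>v (A *\<^sub>v w i)" for i
  have "orthonormal n t u"
    unfolding orthonormal_def
  proof (intro conjI allI impI)
    fix i j assume ij: "i < t" "j < t"
    have "u i \<bullet>c u j = complex_of_real (1 / s i) * cnj (complex_of_real (1 / s j)) *
        ((A *\<^sub>v w i) \<bullet>c (A *\<^sub>v w j))"
      unfolding u_def by (rule cscalar_prod_smult) simp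
    also have "\<dots> = (if i = j then 1 else 0)"
      using ij t[of i] t[of j] by (auto simp: Aw power2_eq_square)
    finally show "u i \<bullet>c u j = (if i = j then 1 else 0)" .
  qed (use A in \<open>simp add: u_def carrier_vecI\<close>)
  \<comment> \<open>The left vectors belonging to zero singular values are arbitrary completions:
    there \<open>A *\<^sub>v w j\<close> vanishes, so any unit vector satisfies the relation with
    factor 0.\<close>
  from orthonormal_extend[OF this \<open>t \<le> m\<close> \<open>m \<le> n\<close>] obtain u'
    where u': "orthonormal n m u'" and uu': "\<And>i. i < t \<Longrightarrow> u' i = u i" by auto
  have u'c: "u' i \<in> carrier_vec n" if "i < m" for i using u' that by (simp add: orthonormal_def)
  have Aw_u': "A *\<^sub>v w j = complex_of_real (s j) \<cdot>\<^sub>v u' j" if j: "j < m" for j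
  proof (cases "j < t")
    case True
    then show ?thesis using t[of j] by (simp add: uu' u_def smult_smult_assoc)
  next
    case False
    then have "s j = 0" using t[of j] j s_nonneg[of j] by auto
    then have "vec_norm2 (A *\<^sub>v w j) = 0" by (simp add: s_def \<sigma>_def w_def)
    then have "A *\<^sub>v w j = 0\<^sub>v n" using vec_norm2_eq_0_iff[of "A *\<^sub>v w j" n] A by (simp add: carrier_vecI)
    then show ?thesis using \<open>s j = 0\<close> u'c[OF j] by auto
  qed
  let ?U = "colmat n m u'" and ?V = "colmat m m w"
  let ?D = "mat_diag m (\<lambda>i. complex_of_real (s i))"
  have AV: "A * ?V = ?U * ?D"
  proof (rule eq_matI)
    fix i j assume "i < dim_row (?U * ?D)" "j < dim_col (?U * ?D)"
    then have ij: "i < n" "j < m" by (simp_all add: mat_diag_def)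
    have "(A * ?V) $$ (i, j) = (A *\<^sub>v w j) $ i"
      using A ij wc by simp
    also have "\<dots> = u' j $ i * complex_of_real (s j)"
      using ij u'c[of j] by (simp add: Aw_u')
    also have "\<dots> = (?U * ?D) $$ (i, j)"
      using ij by (subst mat_diag_mult_right[of _ n]) auto
    finally show "(A * ?V) $$ (i, j) = (?U * ?D) $$ (i, j)" .
  qed (use A in \<open>auto simp: mat_diag_def\<close>)
  \<comment> \<open>Since \<open>w\<close> is a complete basis, the relation \<open>AV\<close> can
    be multiplied by the adjoint of \<open>?V\<close> to recover \<open>A\<close>.\<close>
  have "A = A * (?V * mat_adjoint ?V)"
    unfolding orthonormal_mult_adjoint[OF w] using A by simp
  also have "\<dots> = A * ?V * mat_adjoint ?V"
    using A by (intro mult_mat_assoc_dim[symmetric]) simp_all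
  also have "A * ?V = ?U * ?D" by (rule AV)
  also have D: "?D = mat_diag m (\<lambda>i. complex_of_real (map s [0..<m] ! i))"
    by (auto simp: mat_diag_def)
  finally have eq: "A = ?U * mat_diag m (\<lambda>i. complex_of_real (map s [0..<m] ! i)) * mat_adjoint ?V" .
  have k: "min n m = m" "dim_row A = n" "dim_col A = m"
    using A \<open>m \<le> n\<close> by simp_all
  have "economy_svd A ?U (map s [0..<m]) ?V"
    unfolding economy_svd_def Let_def k
  proof (intro conjI)
    show "\<forall>t\<in>set (map s [0..<m]). 0 \<le> t" using s_nonneg by simp
    show "A = ?U * mat_diag m (\<lambda>i. complex_of_real (map s [0..<m] ! i)) * mat_adjoint ?V"
      by (rule eq)
  qed (simp_all add: sorted orthonormal_adjoint_mult[OF u'] orthonormal_adjoint_mult[OF w])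
  then show ?thesis by blast
qed

text \<open>Taking adjoints exchanges the two isometries and fixes the real diagonal factor, which
  reduces wide matrices to tall ones.\<close>

lemma economy_svd_adjoint:
  assumes "economy_svd (mat_adjoint A) U s V"
  shows "economy_svd A V s U"
proof -
  let ?k = "min (dim_row A) (dim_col A)"
  let ?D = "mat_diag ?k (\<lambda>i. complex_of_real (s ! i))"
  have U: "U \<in> carrier_mat (dim_col A) ?k" and V: "V \<in> carrier_mat (dim_row A) ?k"
    and eq: "mat_adjoint A = U * ?D * mat_adjoint V"
    using assms by (simp_all add: economy_svd_def Let_def min.commute)
  have "A = mat_adjoint (U * ?D * mat_adjoint V)"
    using eq by (metis mat_adjoint_adjoint)
  also have "\<dots> = V * ?D * mat_adjoint U"
    using U V by (simp add: mat_adjoint_mult mult_mat_assoc_dim mat_adjoint_of_real_diag)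
  finally have "A = V * ?D * mat_adjoint U" .
  then show ?thesis
    using assms by (simp add: economy_svd_def Let_def min.commute)
qed

lemma economy_svd_exists: "\<exists>s U V. economy_svd A U s V"
proof (cases "dim_col A \<le> dim_row A")
  case True
  then show ?thesis using economy_svd_exists_tall[of A "dim_row A" "dim_col A"] by auto
next
  case False
  then obtain U s V where "economy_svd (mat_adjoint A) U s V"
    using economy_svd_exists_tall[of "mat_adjoint A" "dim_col A" "dim_row A"] by auto
  then show ?thesis using economy_svd_adjoint by blast
qed

text \<open>Existence ensures that the list picked by the choice operator belongs to an actual
  decomposition.\<close>

lemma economy_svd_singular_values: "\<exists>U V. economy_svd A U (singular_values A) V"
  unfolding singular_values_def by (rule someI_ex) (rule economy_svd_exists)

section \<open>Ranks and column selection\<close>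

text \<open>The product fixes every vector of the form \<open>U *\<^sub>v x\<close>, so it has the
  same range as \<open>U\<close>; and \<open>U\<close> has independent columns because its adjoint
  is a left inverse.\<close>

lemma vec_space_rank_isometry:
  fixes U :: "complex mat"
  assumes U: "U \<in> carrier_mat n r" and UU: "mat_adjoint U * U = 1\<^sub>m r"
  shows "vec_space.rank n (U * mat_adjoint U) = r"
proof -
  interpret vec_space "TYPE(complex)" n .
  have dims: "dim_row U = n" "dim_col U = r" using U by auto
  have UUv: "mat_adjoint U *\<^sub>v (U *\<^sub>v v) = v" if "v \<in> carrier_vec r" for v
    using that UU dims mult_mat_vec_assoc_dim[of "mat_adjoint U" U v] by simp
  have "col_space (U * mat_adjoint U) = col_space U"
  proof -
    have "{y \<in> carrier_vec n. \<exists>x\<in>carrier_vec n. U * mat_adjoint U *\<^sub>v x = y}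
        = {y \<in> carrier_vec n. \<exists>x\<in>carrier_vec r. U *\<^sub>v x = y}"
    proof (intro Collect_cong conj_cong refl iffI; elim bexE)
      fix x y :: "complex vec" assume x: "x \<in> carrier_vec n" "U * mat_adjoint U *\<^sub>v x = y"
      have "U *\<^sub>v (mat_adjoint U *\<^sub>v x) = y"
        using x dims mult_mat_vec_assoc_dim[of U "mat_adjoint U" x] by simp
      then show "\<exists>x\<in>carrier_vec r. U *\<^sub>v x = y"
        using dims by (intro bexI[of _ "mat_adjoint U *\<^sub>v x"] carrier_vecI) simp_all
    next
      fix x y :: "complex vec" assume x: "x \<in> carrier_vec r" "U *\<^sub>v x = y"
      have "dim_vec y = n" unfolding x(2)[symmetric] using dims by simp
      have "U * mat_adjoint U *\<^sub>v y = U *\<^sub>v (mat_adjoint U *\<^sub>v (U *\<^sub>v x))"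
        unfolding x(2)[symmetric] using x(1) dims by (intro mult_mat_vec_assoc_dim) simp_all
      then have "U * mat_adjoint U *\<^sub>v y = y" unfolding UUv[OF x(1)] unfolding x(2) .
      then show "\<exists>x\<in>carrier_vec n. U * mat_adjoint U *\<^sub>v x = y"
        using \<open>dim_vec y = n\<close> by (intro bexI[of _ y] carrier_vecI) simp_all
    qed
    then show ?thesis
      using col_space_eq[of "U * mat_adjoint U" n] col_space_eq[of U r] U dims
        mult_carrier_mat[OF U mat_adjoint_carrier[OF U]] by simp
  qed
  then have "rank (U * mat_adjoint U) = rank U"
    by (simp add: rank_def col_space_def)
  also have "rank U = r"
  proof (rule lin_indpt_full_rank[OF U])
    show dist: "distinct (cols U)"
      unfolding distinct_conv_nth
    proof (intro allI impI)
      fix i j assume "i < length (cols U)" "j < length (cols U)" "i \<noteq> j"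
      then have ij: "i < r" "j < r" "i \<noteq> j" using dims by simp_all
      have "col U i \<bullet>c col U i = 1" "col U j \<bullet>c col U i = 0"
        using arg_cong[OF UU, of "\<lambda>M. M $$ (i, i)"] arg_cong[OF UU, of "\<lambda>M. M $$ (i, j)"] ij dims
          mat_adjoint_mult_index[of i U i U] mat_adjoint_mult_index[of i U j U] by simp_all
      then show "cols U ! i \<noteq> cols U ! j" using ij dims by auto
    qed
    show "lin_indpt (set (cols U))"
    proof
      assume "lin_dep (set (cols U))"
      then obtain v where v: "v \<in> carrier_vec r" "v \<noteq> 0\<^sub>v r" "U *\<^sub>v v = 0\<^sub>v n"
        using lin_depE[OF U _ dist] by metis
      have "v = mat_adjoint U *\<^sub>v 0\<^sub>v n" using UUv[OF v(1)] v(3) by simp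
      also have "\<dots> = 0\<^sub>v r" by (rule eq_vecI) (use dims in auto)
      finally show False using v by simp
    qed
  qed
  finally show ?thesis .
qed

text \<open>The right inverse \<open>R\<close> makes \<open>Z\<close> surjective, so its columns
  span the \<open>r\<close>-dimensional space and a maximal independent set of them is a basis. The
  last conjunct expresses that the selected columns span.\<close>

lemma exists_basis_columns:
  fixes Z R :: "complex mat"
  assumes Z: "Z \<in> carrier_mat r m" and R: "R \<in> carrier_mat m r" and ZR: "Z * R = 1\<^sub>m r"
  shows "\<exists>j. (\<forall>k<r. j k < m) \<and> inj_on (\<lambda>k. col Z (j k)) {..<r} \<and>
    (\<forall>w\<in>carrier_vec r. \<exists>c\<in>carrier_vec r. mat r r (\<lambda>(i, k). Z $$ (i, j k)) *\<^sub>v c = w)"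
proof -
  interpret vec_space "TYPE(complex)" r .
  have "col_space Z = carrier_vec r"
  proof -
    have "\<exists>x\<in>carrier_vec m. Z *\<^sub>v x = w" if "w \<in> carrier_vec r" for w
    proof (rule bexI)
      show "Z *\<^sub>v (R *\<^sub>v w) = w"
        using assoc_mult_mat_vec[OF Z R that] ZR that by simp
      show "R *\<^sub>v w \<in> carrier_vec m" using R by (auto intro: carrier_vecI)
    qed
    then show ?thesis using col_space_eq[OF Z] Z by auto
  qed
  moreover have "vs (carrier_vec r) = V" by (simp add: module_vec_def)
  moreover have "rank Z = vectorspace.dim class_ring (vs (col_space Z))"
    unfolding rank_def col_space_def ..
  ultimately have rank: "rank Z = r" by (simp only: dim_is_n)
  obtain S where S: "maximal S (\<lambda>T. T \<subseteq> set (cols Z) \<and> lin_indpt T)" "finite S"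
  proof -
    have "lin_indpt {}" by (metis empty_subsetI subset_li_is_li unit_vecs_basis basis_def)
    then show ?thesis
      using maximal_exists_superset[of "set (cols Z)" "\<lambda>T. T \<subseteq> set (cols Z) \<and> lin_indpt T" "{}"] that
      by auto
  qed
  have "card S = r" using rank_card_indpt[OF Z S(1)] rank by simp
  then obtain f where f: "bij_betw f {0..<r} S"
    using ex_bij_betw_nat_finite[OF S(2)] by auto
  have SZ: "S \<subseteq> set (cols Z)" and indpt: "lin_indpt S" using S(1) by (auto simp: maximal_def)
  have "\<exists>i<m. f k = col Z i" if "k < r" for k
  proof -
    have "f k \<in> set (cols Z)" using bij_betwE[OF f] that SZ by auto
    then show ?thesis using Z by (auto simp: cols_def)
  qed
  then obtain j where j: "\<And>k. k < r \<Longrightarrow> j k < m" "\<And>k. k < r \<Longrightarrow> f k = col Z (j k)" by metis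
  let ?B = "mat r r (\<lambda>(i, k). Z $$ (i, j k))"
  have B: "?B \<in> carrier_mat r r" by simp
  have colB: "col ?B k = f k" if "k < r" for k
    using that j Z by (intro eq_vecI) auto
  have colsB: "cols ?B = map f [0..<r]"
    by (rule nth_equalityI) (simp_all add: colB del: col_mat)
  have inj: "inj_on f {0..<r}" using f by (simp add: bij_betw_def)
  have "lin_indpt (set (cols ?B))" "distinct (cols ?B)"
    using f indpt by (auto simp: colsB distinct_map bij_betw_def)
  \<comment> \<open>Independent columns of a square matrix exclude a nonzero kernel vector; the
    inverse \<open>C\<close> then solves every system.\<close>
  then have "det ?B \<noteq> 0"
    using lin_depI[OF B] det_0_iff_vec_prod_zero_field[OF B] by blast
  then obtain C where C: "C \<in> carrier_mat r r" "?B * C = 1\<^sub>m r"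
    using det_non_zero_imp_unit[OF B] unfolding Units_def ring_mat_def by auto
  have "\<exists>c\<in>carrier_vec r. ?B *\<^sub>v c = w" if "w \<in> carrier_vec r" for w
  proof (rule bexI)
    show "?B *\<^sub>v (C *\<^sub>v w) = w" using assoc_mult_mat_vec[OF B C(1) that] C that by simp
    show "C *\<^sub>v w \<in> carrier_vec r" using C by (auto intro: carrier_vecI)
  qed
  moreover have "inj_on (\<lambda>k. col Z (j k)) {..<r}"
    using inj j by (auto simp: inj_on_def)
  ultimately show ?thesis using j(1) by blast
qed

section \<open>The Frobenius norm\<close>

lemma vec_norm2_L2_set: "vec_norm2 v = L2_set (\<lambda>i. cmod (v $ i)) {..<dim_vec v}"
  by (simp add: vec_norm2_def L2_set_def)

lemma vec_norm2_minus_le: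
  assumes "v \<in> carrier_vec n" "w \<in> carrier_vec n"
  shows "vec_norm2 (v - w) \<le> vec_norm2 v + vec_norm2 w"
proof -
  have "vec_norm2 (v - w) = L2_set (\<lambda>i. cmod (v $ i - w $ i)) {..<n}"
    using assms by (auto simp: vec_norm2_L2_set intro!: L2_set_cong)
  also have "\<dots> \<le> L2_set (\<lambda>i. cmod (v $ i) + cmod (w $ i)) {..<n}"
    by (intro L2_set_mono norm_triangle_ineq4) auto
  also have "\<dots> \<le> vec_norm2 v + vec_norm2 w"
    using assms L2_set_triangle_ineq by (auto simp: vec_norm2_L2_set)
  finally show ?thesis .
qed

lemma frobenius_norm_nonneg: "0 \<le> frobenius_norm A"
  by (simp add: frobenius_norm_def sum_nonneg)

lemma frobenius_norm_power2:
  "(frobenius_norm A)\<^sup>2 = (\<Sum>i<dim_row A. \<Sum>j<dim_col A. (cmod (A $$ (i, j)))\<^sup>2)"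
  by (simp add: frobenius_norm_def sum_nonneg)

text \<open>Cauchy-Schwarz is applied to each row of \<open>E\<close>, and the squared estimates are
  summed over the rows.\<close>

lemma vec_norm2_mult_mat_vec_le:
  assumes "dim_vec c = dim_col E"
  shows "vec_norm2 (E *\<^sub>v c) \<le> vec_norm2 c * frobenius_norm E"
proof (rule power2_le_imp_le)
  have "(cmod ((E *\<^sub>v c) $ i))\<^sup>2 \<le> (\<Sum>j<dim_col E. (cmod (E $$ (i, j)))\<^sup>2) * (vec_norm2 c)\<^sup>2"
    if i: "i < dim_row E" for i
  proof -
    have "cmod ((E *\<^sub>v c) $ i) \<le> (\<Sum>j<dim_col E. cmod (E $$ (i, j) * c $ j))"
      using i assms by (auto simp: scalar_prod_def lessThan_atLeast0 intro!: sum_norm_le)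
    also have "\<dots> = (\<Sum>j<dim_col E. \<bar>cmod (E $$ (i, j))\<bar> * \<bar>cmod (c $ j)\<bar>)"
      by (simp add: norm_mult)
    also have "\<dots> \<le> L2_set (\<lambda>j. cmod (E $$ (i, j))) {..<dim_col E} * vec_norm2 c"
      unfolding vec_norm2_L2_set assms by (rule L2_set_mult_ineq)
    finally have "(cmod ((E *\<^sub>v c) $ i))\<^sup>2 \<le> (L2_set (\<lambda>j. cmod (E $$ (i, j))) {..<dim_col E} * vec_norm2 c)\<^sup>2"
      by (rule power_mono) simp
    then show ?thesis by (simp add: power_mult_distrib L2_set_def sum_nonneg)
  qed
  then have "(\<Sum>i<dim_row E. (cmod ((E *\<^sub>v c) $ i))\<^sup>2)
      \<le> (\<Sum>i<dim_row E. (\<Sum>j<dim_col E. (cmod (E $$ (i, j)))\<^sup>2) * (vec_norm2 c)\<^sup>2)"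
    by (intro sum_mono) auto
  then show "(vec_norm2 (E *\<^sub>v c))\<^sup>2 \<le> (vec_norm2 c * frobenius_norm E)\<^sup>2"
    by (simp add: power_mult_distrib frobenius_norm_power2 sum_distrib_left[symmetric] mult.commute
      vec_norm2_def[of "E *\<^sub>v c"] sum_nonneg)
qed (simp add: vec_norm2_nonneg frobenius_norm_nonneg)

text \<open>Injectivity of \<open>j\<close> means that no column is counted twice, so only
  nonnegative terms are dropped.\<close>

lemma frobenius_norm_select_columns_le:
  assumes inj: "inj_on j {..<r}" and j: "\<And>k. k < r \<Longrightarrow> j k < dim_col E"
  shows "frobenius_norm (mat (dim_row E) r (\<lambda>(i, k). E $$ (i, j k))) \<le> frobenius_norm E"
proof (rule power2_le_imp_le)
  have "(\<Sum>k<r. (cmod (E $$ (i, j k)))\<^sup>2) \<le> (\<Sum>l<dim_col E. (cmod (E $$ (i, l)))\<^sup>2)" for i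
  proof -
    have "(\<Sum>k<r. (cmod (E $$ (i, j k)))\<^sup>2) = (\<Sum>l\<in>j ` {..<r}. (cmod (E $$ (i, l)))\<^sup>2)"
      using inj by (simp add: sum.reindex)
    also have "\<dots> \<le> (\<Sum>l<dim_col E. (cmod (E $$ (i, l)))\<^sup>2)"
      using j by (intro sum_mono2) auto
    finally show ?thesis .
  qed
  then show "(frobenius_norm (mat (dim_row E) r (\<lambda>(i, k). E $$ (i, j k))))\<^sup>2 \<le> (frobenius_norm E)\<^sup>2"
    by (auto simp: frobenius_norm_power2 intro!: sum_mono)
qed (rule frobenius_norm_nonneg)

lemma frobenius_norm_adjoint: "frobenius_norm (mat_adjoint A) = frobenius_norm A"
proof -
  have "(\<Sum>i<dim_col A. \<Sum>j<dim_row A. (cmod (mat_adjoint A $$ (i, j)))\<^sup>2)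
      = (\<Sum>i<dim_col A. \<Sum>j<dim_row A. (cmod (A $$ (j, i)))\<^sup>2)"
    by simp
  also have "\<dots> = (\<Sum>j<dim_row A. \<Sum>i<dim_col A. (cmod (A $$ (j, i)))\<^sup>2)"
    by (rule sum.swap)
  finally show ?thesis by (simp add: frobenius_norm_def)
qed

section \<open>Invariance of the Frobenius norm under isometries\<close>

lemma frobenius_norm_power2_trace:
  "complex_of_real ((frobenius_norm A)\<^sup>2) = (\<Sum>j<dim_col A. (mat_adjoint A * A) $$ (j, j))"
proof -
  have "complex_of_real ((frobenius_norm A)\<^sup>2)
      = (\<Sum>i<dim_row A. \<Sum>j<dim_col A. complex_of_real ((cmod (A $$ (i, j)))\<^sup>2))"
    by (simp add: frobenius_norm_power2)
  also have "\<dots> = (\<Sum>j<dim_col A. \<Sum>i<dim_row A. complex_of_real ((cmod (A $$ (i, j)))\<^sup>2))"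
    by (rule sum.swap)
  also have "\<dots> = (\<Sum>j<dim_col A. (mat_adjoint A * A) $$ (j, j))"
    by (simp add: scalar_prod_def lessThan_atLeast0 complex_norm_square mult.commute del: of_real_power)
  finally show ?thesis .
qed

lemma isometry_cancel:
  fixes U :: "complex mat"
  assumes "mat_adjoint U * U = 1\<^sub>m k" "dim_row B = k"
  shows "mat_adjoint U * (U * B) = B"
proof -
  have "dim_col U = k" using arg_cong[OF assms(1), of dim_row] by simp
  then have "mat_adjoint U * (U * B) = mat_adjoint U * U * B"
    using assms by (intro mult_mat_assoc_dim[symmetric]) simp_all
  then show ?thesis using assms left_mult_one_mat'[of B k] by simp
qed

text \<open>The squared norm is the trace of the Gram matrix, in which the isometry cancels against
  its adjoint.\<close>

lemma frobenius_norm_isometry_mult: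
  assumes "mat_adjoint U * U = 1\<^sub>m k" "dim_row B = k"
  shows "frobenius_norm (U * B) = frobenius_norm B"
proof -
  have "dim_col U = k" using arg_cong[OF assms(1), of dim_row] by simp
  then have "mat_adjoint (U * B) * (U * B) = mat_adjoint B * B"
    using assms isometry_cancel[OF assms] by (simp add: mat_adjoint_mult mult_mat_assoc_dim)
  then have "complex_of_real ((frobenius_norm (U * B))\<^sup>2) = complex_of_real ((frobenius_norm B)\<^sup>2)"
    unfolding frobenius_norm_power2_trace by simp
  then have "(frobenius_norm (U * B))\<^sup>2 = (frobenius_norm B)\<^sup>2"
    unfolding of_real_eq_iff .
  then show ?thesis using frobenius_norm_nonneg by simp
qed

lemma frobenius_norm_mult_isometry_adjoint:
  assumes "mat_adjoint V * V = 1\<^sub>m k" "dim_col B = k"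
  shows "frobenius_norm (B * mat_adjoint V) = frobenius_norm B"
proof -
  have "dim_col V = k" using arg_cong[OF assms(1), of dim_row] by simp
  then have "mat_adjoint (B * mat_adjoint V) = V * mat_adjoint B"
    using assms by (simp add: mat_adjoint_mult)
  then show ?thesis
    using frobenius_norm_isometry_mult[OF assms(1), of "mat_adjoint B"] assms(2)
      frobenius_norm_adjoint[of "B * mat_adjoint V"] frobenius_norm_adjoint[of B] by simp
qed

section \<open>Projection onto the dominant left singular vectors\<close>

lemma rk_threshold:
  assumes "economy_svd X U (singular_values X) V"
  shows "rk \<delta> X \<le> min (dim_row X) (dim_col X)"
    and "j < min (dim_row X) (dim_col X) \<Longrightarrow> singular_values X ! j > \<delta> \<longleftrightarrow> j < rk \<delta> X"
proof -
  let ?k = "min (dim_row X) (dim_col X)" and ?s = "singular_values X"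
  have len: "length ?s = ?k" and sorted: "sorted_wrt (\<ge>) ?s"
    using assms by (simp_all add: economy_svd_def Let_def)
  have mono: "?s ! j \<le> ?s ! i" if "i \<le> j" "j < ?k" for i j
    using sorted_wrt_nth_less[OF sorted, of i j] that len by (cases "i = j") auto
  have "{j. j < ?k \<and> ?s ! j > \<delta>} = {..<rk \<delta> X}"
    unfolding rk_def
    by (rule downward_closed_eq_lessThan) (use mono in \<open>force intro: less_le_trans\<close>)+
  then have *: "j < rk \<delta> X \<longleftrightarrow> j < ?k \<and> ?s ! j > \<delta>" for j by blast
  show "rk \<delta> X \<le> ?k" using *[of ?k] by (simp add: not_less)
  show "?s ! j > \<delta> \<longleftrightarrow> j < rk \<delta> X" if "j < ?k" using * that by blast
qed

text \<open>\<open>W\<close> consists of the first \<open>r\<close> left singular vectors. The right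
  inverse \<open>R\<close> certifies that the coordinate matrix \<open>mat_adjoint W * X\<close> has
  full row rank, in the form needed for selecting columns.\<close>

lemma rank_delta_projection:
  fixes X :: "complex mat" and \<delta> :: real
  assumes X: "X \<in> carrier_mat n m" and "\<delta> > 0" and r: "r = rk \<delta> X"
  obtains W R where
    "W \<in> carrier_mat n r" "mat_adjoint W * W = 1\<^sub>m r"
    "R \<in> carrier_mat m r" "mat_adjoint W * X * R = 1\<^sub>m r"
    "frobenius_norm (X - W * mat_adjoint W * X) \<le> sqrt (real (min m n) - real r) * \<delta>"
    "r \<le> min m n"
proof -
  define s where "s = singular_values X"
  define k where "k = min n m"
  obtain U V where svd: "economy_svd X U s V"
    using economy_svd_singular_values unfolding s_def by blast
  have U: "U \<in> carrier_mat n k" and UU: "mat_adjoint U * U = 1\<^sub>m k"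
    and V: "V \<in> carrier_mat m k" and VV: "mat_adjoint V * V = 1\<^sub>m k"
    and nonneg: "\<forall>t\<in>set s. 0 \<le> t" and len: "length s = k"
    and eq: "X = U * mat_diag k (\<lambda>i. complex_of_real (s ! i)) * mat_adjoint V"
    using svd X by (simp_all add: economy_svd_def Let_def k_def)
  have rk: "r \<le> k" "\<And>j. j < k \<Longrightarrow> s ! j > \<delta> \<longleftrightarrow> j < r"
    using rk_threshold[OF svd[unfolded s_def], where \<delta> = \<delta>] X by (simp_all add: s_def k_def r)
  define D where "D = mat_diag k (\<lambda>i. complex_of_real (s ! i))"
  \<comment> \<open>Entries with \<open>s ! i = 0\<close> become 0 by the convention for division.
    Only the first \<open>r\<close> entries enter \<open>R\<close>, and there
    \<open>s ! i > \<delta> > 0\<close>.\<close>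
  define D' where "D' = mat_diag k (\<lambda>i. 1 / complex_of_real (s ! i))"
  \<comment> \<open>The columns of \<open>P\<close> are the first \<open>r\<close> standard basis
    vectors: \<open>U * P\<close> keeps the first \<open>r\<close> columns of \<open>U\<close>, and
    \<open>P * mat_adjoint P\<close> is the coordinate projection.\<close>
  define P where "P = mat k r (\<lambda>(i, j). if i = j then 1 else 0 :: complex)"
  define E where "E = mat_diag k (\<lambda>i. if i < r then 0 else complex_of_real (s ! i))"
  have dims [simp]: "dim_row U = n" "dim_col U = k" "dim_row V = m" "dim_col V = k"
    "dim_row D = k" "dim_col D = k" "dim_row D' = k" "dim_col D' = k"
    "dim_row P = k" "dim_col P = r" "dim_row E = k" "dim_col E = k"
    using U V by (simp_all add: D_def D'_def P_def E_def)
  \<comment> \<open>Compression by \<open>P\<close> cuts out the leading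
    \<open>r\<close>-by-\<open>r\<close> block of a diagonal matrix.\<close>
  have Peq: "mat_adjoint P * (mat_diag k f * P) = mat_diag r f" for f
  proof (rule eq_matI)
    fix i j assume "i < dim_row (mat_diag r f)" "j < dim_col (mat_diag r f)"
    then have ij: "i < r" "j < r" by simp_all
    have DP: "mat_diag k f * P = mat k r (\<lambda>(i, j). if i = j then f i else 0)"
      by (subst mat_diag_mult_left[of P k r]) (auto simp: P_def)
    have "(mat_adjoint P * (mat_diag k f * P)) $$ (i, j)
        = (\<Sum>l<k. mat_adjoint P $$ (i, l) * mat k r (\<lambda>(i, j). if i = j then f i else 0) $$ (l, j))"
      unfolding DP using ij by (simp add: scalar_prod_def lessThan_atLeast0)
    also have "\<dots> = (\<Sum>l<k. (if l = i then 1 else 0) * (if l = j then f l else 0))"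
      using ij rk(1) by (intro sum.cong) (auto simp: P_def)
    also have "\<dots> = (\<Sum>l<k. if l = i then (if i = j then f i else 0) else 0)"
      by (rule sum.cong) auto
    also have "\<dots> = mat_diag r f $$ (i, j)"
      using ij rk(1) by (simp add: mat_diag_def)
    finally show "(mat_adjoint P * (mat_diag k f * P)) $$ (i, j) = mat_diag r f $$ (i, j)" .
  qed simp_all
  have PP: "P * mat_adjoint P = mat_diag k (\<lambda>i. if i < r then 1 else 0)"
  proof (rule eq_matI)
    fix i j assume "i < dim_row (mat_diag k (\<lambda>i. if i < r then 1 else 0 :: complex))"
      "j < dim_col (mat_diag k (\<lambda>i. if i < r then 1 else 0 :: complex))"
    then have ij: "i < k" "j < k" by simp_all
    have "(P * mat_adjoint P) $$ (i, j) = (\<Sum>l<r. P $$ (i, l) * mat_adjoint P $$ (l, j))"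
      using ij by (simp add: scalar_prod_def lessThan_atLeast0)
    also have "\<dots> = (\<Sum>l<r. (if i = l then 1 else 0) * (if j = l then 1 else 0))"
      using ij by (intro sum.cong) (auto simp: P_def)
    also have "\<dots> = (\<Sum>l<r. if l = i then (if i = j then 1 else 0) else 0)"
      by (rule sum.cong) auto
    also have "\<dots> = mat_diag k (\<lambda>i. if i < r then 1 else 0) $$ (i, j)"
      using ij by (auto simp: mat_diag_def)
    finally show "(P * mat_adjoint P) $$ (i, j) = mat_diag k (\<lambda>i. if i < r then 1 else 0) $$ (i, j)" .
  qed simp_all
  have PPI: "mat_adjoint P * P = 1\<^sub>m r"
    using Peq[of "\<lambda>_. 1"] left_mult_one_mat'[of P k] by simp
  have Xeq: "X = U * (D * mat_adjoint V)"
    unfolding eq D_def[symmetric] by (rule mult_mat_assoc_dim) simp_all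
  define W where "W = U * P"
  define R where "R = V * (D' * P)"
  have W: "W \<in> carrier_mat n r" and R: "R \<in> carrier_mat m r"
    by (auto simp: W_def R_def intro: carrier_matI)
  have WW: "mat_adjoint W * W = 1\<^sub>m r"
    using isometry_cancel[OF UU, of P] PPI by (simp add: W_def mat_adjoint_mult mult_mat_assoc_dim)
  have WX: "mat_adjoint W * X = mat_adjoint P * (D * mat_adjoint V)"
    using isometry_cancel[OF UU, of "D * mat_adjoint V"]
    by (simp add: W_def Xeq mat_adjoint_mult mult_mat_assoc_dim)
  have "mat_adjoint W * X * R = mat_adjoint P * (D * (D' * P))"
    unfolding WX using isometry_cancel[OF VV, of "D' * P"]
    by (simp add: R_def mult_mat_assoc_dim)
  also have "D * (D' * P) = mat_diag k (\<lambda>i. complex_of_real (s ! i) * (1 / complex_of_real (s ! i))) * P"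
    unfolding D_def D'_def mat_diag_diag[symmetric]
    by (intro mult_mat_assoc_dim[symmetric]) simp_all
  also have "mat_adjoint P * \<dots> = 1\<^sub>m r"
    unfolding Peq
  proof (rule eq_matI)
    fix i j assume "i < dim_row (1\<^sub>m r :: complex mat)" "j < dim_col (1\<^sub>m r :: complex mat)"
    then show "mat_diag r (\<lambda>i. complex_of_real (s ! i) * (1 / complex_of_real (s ! i))) $$ (i, j) = 1\<^sub>m r $$ (i, j)"
      using rk(1) rk(2)[of i] \<open>\<delta> > 0\<close> by (auto simp: mat_diag_def)
  qed simp_all
  finally have WXR: "mat_adjoint W * X * R = 1\<^sub>m r" .
  have "W * mat_adjoint W * X = W * (mat_adjoint W * X)"
    using W X by (intro mult_mat_assoc_dim) simp_all
  also have "\<dots> = U * (P * (mat_adjoint P * (D * mat_adjoint V)))"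
    unfolding WX by (simp add: W_def mult_mat_assoc_dim)
  also have "P * (mat_adjoint P * (D * mat_adjoint V)) = P * mat_adjoint P * D * mat_adjoint V"
    by (simp add: mult_mat_assoc_dim)
  finally have QX: "W * mat_adjoint W * X = U * (P * mat_adjoint P * D * mat_adjoint V)" .
  \<comment> \<open>In singular coordinates the projection keeps the leading \<open>r\<close>
    values, so the remainder is the diagonal tail \<open>E\<close>.\<close>
  have E: "D - P * mat_adjoint P * D = E"
    unfolding PP D_def mat_diag_diag E_def by (rule eq_matI) (auto simp: mat_diag_def)
  have "X - W * mat_adjoint W * X = U * (D * mat_adjoint V - P * mat_adjoint P * D * mat_adjoint V)"
    unfolding QX unfolding Xeq by (rule mult_minus_distrib_mat[symmetric, OF U]) (auto intro: carrier_matI)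
  also have "D * mat_adjoint V - P * mat_adjoint P * D * mat_adjoint V = E * mat_adjoint V"
    unfolding E[symmetric]
    by (rule minus_mult_distrib_mat[symmetric, of _ k k _ _ m]) (auto intro: carrier_matI)
  finally have "frobenius_norm (X - W * mat_adjoint W * X) = frobenius_norm E"
    using frobenius_norm_isometry_mult[OF UU, of "E * mat_adjoint V"]
      frobenius_norm_mult_isometry_adjoint[OF VV, of E] by simp
  also have "\<dots> \<le> sqrt (real (min m n) - real r) * \<delta>"
  proof (rule power2_le_imp_le)
    have "(frobenius_norm E)\<^sup>2 = (\<Sum>i<k. \<Sum>j<k. if i = j then (if i < r then 0 else (s ! i)\<^sup>2) else 0)"
      unfolding frobenius_norm_power2 dims
      by (intro sum.cong refl) (simp add: E_def mat_diag_def)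
    also have "\<dots> = (\<Sum>i<k. if i < r then 0 else (s ! i)\<^sup>2)" by simp
    \<comment> \<open>Past index \<open>r\<close> the values lie between 0 and
      \<open>\<delta>\<close>; there are \<open>k - r\<close> of them.\<close>
    also have "\<dots> \<le> (\<Sum>i<k. if i < r then 0 else \<delta>\<^sup>2)"
    proof (intro sum_mono)
      fix i assume "i \<in> {..<k}"
      then show "(if i < r then 0 else (s ! i)\<^sup>2) \<le> (if i < r then 0 else \<delta>\<^sup>2)"
        using rk(2)[of i] nonneg len by (auto intro!: power_mono)
    qed
    also have "\<dots> = (\<Sum>i\<in>{r..<k}. \<delta>\<^sup>2)"
      by (rule sum.mono_neutral_cong_right) auto
    also have "\<dots> = (sqrt (real (min m n) - real r) * \<delta>)\<^sup>2"
      using rk(1) by (simp add: k_def power_mult_distrib of_nat_diff min.commute)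
    finally show "(frobenius_norm E)\<^sup>2 \<le> (sqrt (real (min m n) - real r) * \<delta>)\<^sup>2" .
    show "0 \<le> sqrt (real (min m n) - real r) * \<delta>"
      using rk(1) \<open>\<delta> > 0\<close> by (auto simp: k_def)
  qed
  finally show thesis
    using that[OF W WW R WXR] rk(1) by (auto simp: k_def)
qed

section \<open>The projector and the residual of an approximation\<close>

lemma isometry_orthogonal_projector:
  assumes W: "W \<in> carrier_mat n r" and WW: "mat_adjoint W * W = 1\<^sub>m r"
  shows "orthogonal_projector (W * mat_adjoint W)"
  using W isometry_cancel[OF WW, of "mat_adjoint W"]
  by (simp add: orthogonal_projector_def mat_adjoint_mult mult_mat_assoc_dim)

text \<open>The hypothesis \<open>coord\<close> says that \<open>y\<close> and
  \<open>B *\<^sub>v c\<close> have the same projection. Their difference therefore equals the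
  difference of their components orthogonal to the range of \<open>W\<close>.\<close>

lemma norm_residual_le:
  fixes W B :: "complex mat"
  assumes W: "W \<in> carrier_mat n r" and B: "B \<in> carrier_mat n r"
    and y: "y \<in> carrier_vec n" and c: "c \<in> carrier_vec r"
    and coord: "mat_adjoint W * B *\<^sub>v c = mat_adjoint W *\<^sub>v y"
  shows "vec_norm2 (y - B *\<^sub>v c)
    \<le> vec_norm2 c * frobenius_norm (B - W * mat_adjoint W * B) + vec_norm2 ((1\<^sub>m n - W * mat_adjoint W) *\<^sub>v y)"
proof -
  let ?Q = "W * mat_adjoint W"
  have Q: "?Q \<in> carrier_mat n n" using W by (auto intro: carrier_matI)
  have Bc: "B *\<^sub>v c \<in> carrier_vec n" and Qy: "?Q *\<^sub>v y \<in> carrier_vec n"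
    and QB: "?Q * B \<in> carrier_mat n r"
    using W B by (auto intro: carrier_vecI carrier_matI)
  have "?Q * B *\<^sub>v c = W *\<^sub>v (mat_adjoint W * B *\<^sub>v c)"
    using W B c by (simp add: mult_mat_assoc_dim mult_mat_vec_assoc_dim)
  also have "\<dots> = ?Q *\<^sub>v y"
    unfolding coord using W y by (simp add: mult_mat_vec_assoc_dim)
  finally have QBc: "?Q * B *\<^sub>v c = ?Q *\<^sub>v y" .
  have y1: "(1\<^sub>m n - ?Q) *\<^sub>v y = y - ?Q *\<^sub>v y"
    using minus_mult_distrib_mat_vec[OF one_carrier_mat Q y] y by simp
  have B1: "(B - ?Q * B) *\<^sub>v c = B *\<^sub>v c - ?Q *\<^sub>v y"
    using minus_mult_distrib_mat_vec[OF B QB c] QBc by simp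
  have "y - B *\<^sub>v c = (1\<^sub>m n - ?Q) *\<^sub>v y - (B - ?Q * B) *\<^sub>v c"
    unfolding y1 B1 using y Bc Qy W B by (intro eq_vecI) (auto simp: carrier_vecD[OF y])
  also have "vec_norm2 \<dots> \<le> vec_norm2 ((1\<^sub>m n - ?Q) *\<^sub>v y) + vec_norm2 ((B - ?Q * B) *\<^sub>v c)"
    using Q B W by (intro vec_norm2_minus_le[of _ n]) (auto intro: carrier_vecI)
  also have "vec_norm2 ((B - ?Q * B) *\<^sub>v c) \<le> vec_norm2 c * frobenius_norm (B - ?Q * B)"
    using B c by (intro vec_norm2_mult_mat_vec_le) auto
  finally show ?thesis by simp
qed

theorem theorem3p4:
  fixes \<delta> :: real and n m r :: nat
    and y :: "complex vec" and x :: "nat \<Rightarrow> complex vec" and X :: "complex mat"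
  assumes "\<delta> > 0"
    and "y \<in> carrier_vec n"
    and "\<And>j. j < m \<Longrightarrow> x j \<in> carrier_vec n"
    and "X = mat_of_cols n (map x [0..<m])"
    and "r = rk \<delta> X"
    and "r > 0"
  shows "\<exists>(Q :: complex mat) (j :: nat \<Rightarrow> nat) (c :: nat \<Rightarrow> complex).
           Q \<in> carrier_mat n n \<and> orthogonal_projector Q \<and> vec_space.rank n Q = r \<and>
           (\<forall>k<r. j k < m) \<and> inj_on (\<lambda>k. x (j k)) {..<r} \<and>
           frobenius_norm (X - Q * X) \<le> s_nmr n m r / sqrt (real r) * \<delta> \<and>
           vec_norm2 (y - finsum_vec TYPE(complex) n (\<lambda>k. c k \<cdot>\<^sub>v x (j k)) {..<r})
             \<le> sqrt (\<Sum>k<r. (cmod (c k))\<^sup>2) * s_nmr n m r * \<delta>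
                + vec_norm2 ((1\<^sub>m n - Q) *\<^sub>v y)"
proof -
  have X: "X \<in> carrier_mat n m" and colX: "\<And>j. j < m \<Longrightarrow> col X j = x j"
    using assms(3,4) by (auto simp: carrier_matI)
  obtain W R where W: "W \<in> carrier_mat n r" and WW: "mat_adjoint W * W = 1\<^sub>m r"
    and R: "R \<in> carrier_mat m r" "mat_adjoint W * X * R = 1\<^sub>m r"
    and frob: "frobenius_norm (X - W * mat_adjoint W * X) \<le> sqrt (real (min m n) - real r) * \<delta>"
    and r: "r \<le> min m n"
    using rank_delta_projection[OF X assms(1,5)] by blast
  let ?Q = "W * mat_adjoint W" and ?Z = "mat_adjoint W * X" and ?d = "sqrt (real (min m n) - real r) * \<delta>"
  have s: "s_nmr n m r = sqrt (real r) * sqrt (real (min m n) - real r)"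
    by (simp add: s_nmr_def real_sqrt_mult)
  have Z: "?Z \<in> carrier_mat r m" using W X by (auto intro: carrier_matI)
  obtain j where j: "\<And>k. k < r \<Longrightarrow> j k < m" and inj: "inj_on (\<lambda>k. col ?Z (j k)) {..<r}"
    and solve: "\<forall>w\<in>carrier_vec r. \<exists>c\<in>carrier_vec r. mat r r (\<lambda>(i, k). ?Z $$ (i, j k)) *\<^sub>v c = w"
    using exists_basis_columns[OF Z R] by auto
  have colZ: "col ?Z (j k) = mat_adjoint W *\<^sub>v x (j k)" if "k < r" for k
    using j[OF that] colX col_mult2[OF mat_adjoint_carrier[OF W] X] by metis
  \<comment> \<open>\<open>B\<close> collects the selected columns of \<open>X\<close>, so that the
    coefficients act as a matrix-vector product and the selected columns of \<open>?Z\<close> are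
    those of \<open>mat_adjoint W * B\<close>.\<close>
  define B where "B = mat n r (\<lambda>(i, k). X $$ (i, j k))"
  have B: "B \<in> carrier_mat n r" by (simp add: B_def)
  have colB: "col B k = x (j k)" if "k < r" for k
    unfolding colX[OF j[OF that], symmetric] using X j[OF that] that
    by (intro eq_vecI) (auto simp: B_def)
  have ZB: "mat r r (\<lambda>(i, k). ?Z $$ (i, j k)) = mat_adjoint W * B"
  proof (rule eq_matI)
    fix i k assume "i < dim_row (mat_adjoint W * B)" "k < dim_col (mat_adjoint W * B)"
    then have "i < r" "k < r" using W B by auto
    then show "mat r r (\<lambda>(i, k). ?Z $$ (i, j k)) $$ (i, k) = (mat_adjoint W * B) $$ (i, k)"
      using W X B j[of k] colB[of k] colX[of "j k"] by simp
  qed (use W B in auto)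
  have "mat_adjoint W *\<^sub>v y \<in> carrier_vec r" using W by (auto intro: carrier_vecI)
  then obtain c where c: "c \<in> carrier_vec r" "mat_adjoint W * B *\<^sub>v c = mat_adjoint W *\<^sub>v y"
    using solve unfolding ZB by blast
  have sum: "finsum_vec TYPE(complex) n (\<lambda>k. (c $ k) \<cdot>\<^sub>v x (j k)) {..<r} = B *\<^sub>v c"
  proof (rule eq_vecI)
    have car: "(\<lambda>k. (c $ k) \<cdot>\<^sub>v x (j k)) \<in> {..<r} \<rightarrow> carrier_vec n" using assms(3) j by auto
    show "dim_vec (finsum_vec TYPE(complex) n (\<lambda>k. (c $ k) \<cdot>\<^sub>v x (j k)) {..<r}) = dim_vec (B *\<^sub>v c)"
      using finsum_vec_closed[OF car] B by auto
    fix i assume "i < dim_vec (B *\<^sub>v c)"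
    then have i: "i < n" using B by simp
    have "finsum_vec TYPE(complex) n (\<lambda>k. (c $ k) \<cdot>\<^sub>v x (j k)) {..<r} $ i = (\<Sum>k<r. ((c $ k) \<cdot>\<^sub>v x (j k)) $ i)"
      by (rule index_finsum_vec[OF _ i car]) simp
    also have "\<dots> = (\<Sum>k<r. B $$ (i, k) * c $ k)"
    proof (rule sum.cong[OF refl])
      fix k assume "k \<in> {..<r}"
      then have k: "k < r" by simp
      have "dim_vec (x (j k)) = n" "B $$ (i, k) = x (j k) $ i"
        using assms(3)[OF j[OF k]] arg_cong[OF colB[OF k], of "\<lambda>v. v $ i"] i k B by auto
      then show "((c $ k) \<cdot>\<^sub>v x (j k)) $ i = B $$ (i, k) * c $ k" using i by simp
    qed
    also have "\<dots> = (B *\<^sub>v c) $ i"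
      using i B c by (simp add: scalar_prod_def lessThan_atLeast0)
    finally show "finsum_vec TYPE(complex) n (\<lambda>k. (c $ k) \<cdot>\<^sub>v x (j k)) {..<r} $ i = (B *\<^sub>v c) $ i" .
  qed
  \<comment> \<open>Distinct columns of \<open>?Z\<close> force distinct indices, so
    \<open>B - ?Q * B\<close> is a genuine column selection from \<open>X - ?Q * X\<close>.\<close>
  have "inj_on j {..<r}" using inj by (auto simp: inj_on_def)
  then have "frobenius_norm (mat n r (\<lambda>(i, k). (X - ?Q * X) $$ (i, j k))) \<le> frobenius_norm (X - ?Q * X)"
    using frobenius_norm_select_columns_le[of j r "X - ?Q * X"] j W X by simp
  also have "mat n r (\<lambda>(i, k). (X - ?Q * X) $$ (i, j k)) = B - ?Q * B"
  proof (rule eq_matI)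
    fix i k assume "i < dim_row (B - ?Q * B)" "k < dim_col (B - ?Q * B)"
    then have "i < n" "k < r" using W B by auto
    then show "mat n r (\<lambda>(i, k). (X - ?Q * X) $$ (i, j k)) $$ (i, k) = (B - ?Q * B) $$ (i, k)"
      using W X j[of k] colB[of k] colX[of "j k"] by (simp add: B_def)
  qed (use W B in auto)
  also note frob
  \<comment> \<open>The right side is \<open>sqrt (real r) * ?d\<close>, and
    \<open>sqrt (real r) \<ge> 1\<close> because \<open>r > 0\<close>.\<close>
  also have "?d \<le> s_nmr n m r * \<delta>"
    unfolding s using mult_right_mono[of 1 "sqrt (real r)" ?d] assms(1,6) r by simp
  finally have "vec_norm2 c * frobenius_norm (B - ?Q * B) \<le> vec_norm2 c * (s_nmr n m r * \<delta>)"
    by (intro mult_left_mono vec_norm2_nonneg)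
  moreover have "vec_norm2 c = sqrt (\<Sum>k<r. (cmod (c $ k))\<^sup>2)"
    using c by (simp add: vec_norm2_def)
  ultimately have bound: "vec_norm2 (y - finsum_vec TYPE(complex) n (\<lambda>k. (c $ k) \<cdot>\<^sub>v x (j k)) {..<r})
      \<le> sqrt (\<Sum>k<r. (cmod (c $ k))\<^sup>2) * s_nmr n m r * \<delta> + vec_norm2 ((1\<^sub>m n - ?Q) *\<^sub>v y)"
    unfolding sum using norm_residual_le[OF W B assms(2) c] by (simp add: mult.assoc)
  have "?Q \<in> carrier_mat n n" using W by (auto intro: carrier_matI)
  \<comment> \<open>Equal vectors \<open>x (j k)\<close> would have equal images under
    \<open>mat_adjoint W\<close>, which are the distinct selected columns of
    \<open>?Z\<close>.\<close>
  moreover have "inj_on (\<lambda>k. x (j k)) {..<r}"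
    using inj colZ by (auto simp: inj_on_def)
  moreover have "frobenius_norm (X - ?Q * X) \<le> s_nmr n m r / sqrt (real r) * \<delta>"
    using frob assms(6) by (simp add: s)
  ultimately show ?thesis
    using isometry_orthogonal_projector[OF W WW] vec_space_rank_isometry[OF W WW] j bound
    by (intro exI[of _ ?Q] exI[of _ j] exI[of _ "\<lambda>k. c $ k"]) simp
qed

end
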